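(* Let $\tilde Q_n$ be the tilde-hypercube of order $n$. Then $|E(\tilde Q_1)|=1$ and, for all $n\ge 2$, $$|E(\tilde Q_n)|=2\,|E(\tilde Q_{n-1})|+2^{n-1}+2^{n-2}.$$
   Context: For binary words $u,v$ of equal length, the tilde-distance $\mathrm{dist}_\sim(u,v)$ is the minimum number of replacements (changing the symbol in one position to the opposite symbol) and swaps (exchanging two adjacent different symbols) needed to transform $u$ into $v$. The tilde-hypercube $\tilde Q_n$ of order $n\ge1$ is the (simple, undirected) graph whose vertices are the $2^n$ binary words of length $n$, two vertices being adjacent exactly when their tilde-distance is $1$. $E(G)$ denotes the edge set of a graph $G$. *)

theory Defs
  imports Main
begin

definition replacement :: "bool list \<Rightarrow> bool list \<Rightarrow> bool" where
  "replacement u v \<longleftrightarrow> (\<exists>i < length u. v = u[i := \<not> u ! i])"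

definition adjacent_swap :: "bool list \<Rightarrow> bool list \<Rightarrow> bool" where
  "adjacent_swap u v \<longleftrightarrow>
     (\<exists>i. Suc i < length u \<and> u ! i \<noteq> u ! Suc i \<and> v = u[i := u ! Suc i, Suc i := u ! i])"

definition tilde_step :: "bool list \<Rightarrow> bool list \<Rightarrow> bool" where
  "tilde_step u v \<longleftrightarrow> replacement u v \<or> adjacent_swap u v"

(* Meaningful only when length u = length v; the minimum is then attained,
   see tilde_dist_attained. *)
definition tilde_dist :: "bool list \<Rightarrow> bool list \<Rightarrow> nat" where
  "tilde_dist u v = (LEAST k. (tilde_step ^^ k) u v)"

lemma tilde_step_Cons: "tilde_step u v \<Longrightarrow> tilde_step (a # u) (a # v)"
proof -
  assume "tilde_step u v"
  then consider "replacement u v" | "adjacent_swap u v"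
    unfolding tilde_step_def by blast
  then show ?thesis
  proof cases
    case 1
    then obtain i where "i < length u" "v = u[i := \<not> u ! i]"
      unfolding replacement_def by blast
    then have "replacement (a # u) (a # v)"
      unfolding replacement_def by (intro exI[of _ "Suc i"]) simp
    then show ?thesis unfolding tilde_step_def by blast
  next
    case 2
    then obtain i where "Suc i < length u" "u ! i \<noteq> u ! Suc i"
      "v = u[i := u ! Suc i, Suc i := u ! i]"
      unfolding adjacent_swap_def by blast
    then have "adjacent_swap (a # u) (a # v)"
      unfolding adjacent_swap_def by (intro exI[of _ "Suc i"]) simp
    then show ?thesis unfolding tilde_step_def by blast
  qed
qed

lemma tilde_step_reachable:
  "length u = length v \<Longrightarrow> tilde_step\<^sup>*\<^sup>* u v"
proof (induction u v rule: list_induct2)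
  case Nil
  then show ?case by simp
next
  case (Cons x xs y ys)
  from Cons.IH have *: "tilde_step\<^sup>*\<^sup>* (x # xs) (x # ys)"
    by (induction rule: rtranclp_induct)
      (auto intro: tilde_step_Cons rtranclp.rtrancl_into_rtrancl)
  show ?case
  proof (cases "x = y")
    case False
    then have "replacement (x # ys) (y # ys)"
      unfolding replacement_def by (intro exI[of _ 0]) auto
    then have "tilde_step (x # ys) (y # ys)"
      unfolding tilde_step_def by blast
    with * show ?thesis by (rule rtranclp.rtrancl_into_rtrancl)
  qed (use * in simp)
qed

lemma tilde_dist_attained:
  assumes "length u = length v"
  shows "(tilde_step ^^ tilde_dist u v) u v"
proof -
  obtain k where "(tilde_step ^^ k) u v"
    using rtranclp_imp_relpowp[OF tilde_step_reachable[OF assms]] by blast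
  then show ?thesis unfolding tilde_dist_def by (rule LeastI)
qed

record 'a ugraph =
  vertex_set :: "'a set"
  edge_set :: "'a set set"

definition binary_words :: "nat \<Rightarrow> bool list set" where
  "binary_words n = {w. length w = n}"

definition tilde_hypercube :: "nat \<Rightarrow> bool list ugraph" where
  "tilde_hypercube n =
     \<lparr>vertex_set = binary_words n,
      edge_set = {{u, v} | u v. u \<in> binary_words n \<and> v \<in> binary_words n \<and> tilde_dist u v = 1}\<rparr>"

end

theory Submission
  imports Defs
begin

text \<open>Split the edges of the hypercube of order \<open>n\<close> by the first letters of their endpoints.
  If these agree, deleting them leaves an edge of order \<open>n - 1\<close>, which gives two copies of that
  edge set. If they differ, either the first letter was replaced, and the common tail is any of
  \<open>2 ^ (n - 1)\<close> words, or the first two letters were swapped, and the common rest is any of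
  \<open>2 ^ (n - 2)\<close> words.\<close>

lemma replacement_Cons_iff:
  "replacement (a # u) (b # v) \<longleftrightarrow> a = b \<and> replacement u v \<or> a \<noteq> b \<and> u = v"
  unfolding replacement_def by (auto simp: Ex_less_Suc2)

text \<open>A swap at position 0 exchanges two different letters, so it always changes the first
  letter; a swap at any later position keeps it. Comparing \<open>a\<close> with \<open>b\<close>
  therefore tells which kind occurred.\<close>

lemma adjacent_swap_Cons_iff:
  "adjacent_swap (a # u) (b # v) \<longleftrightarrow>
     a = b \<and> adjacent_swap u v \<or> a \<noteq> b \<and> (\<exists>w. u = b # w \<and> v = a # w)"
proof -
  have split: "(\<exists>i. P i) \<longleftrightarrow> P 0 \<or> (\<exists>i. P (Suc i))" for P :: "nat \<Rightarrow> bool"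
    by (metis not0_implies_Suc)
  show ?thesis
    unfolding adjacent_swap_def by (subst split) (cases u; auto)
qed

lemma tilde_step_Cons_iff:
  "tilde_step (a # u) (b # v) \<longleftrightarrow>
     a = b \<and> tilde_step u v \<or> a \<noteq> b \<and> (u = v \<or> (\<exists>w. u = b # w \<and> v = a # w))"
  unfolding tilde_step_def replacement_Cons_iff adjacent_swap_Cons_iff by blast

text \<open>Rules out loops: a word is never one operation away from itself, so distance 1 is not
  confused with distance 0 and no edge is a singleton.\<close>

lemma tilde_step_irrefl: "\<not> tilde_step u u"
proof (induction u)
  case Nil
  show ?case by (simp add: tilde_step_def replacement_def adjacent_swap_def)
qed (simp add: tilde_step_Cons_iff)

text \<open>Equal lengths ensure that the minimum is attained, so distance 0 would force
  \<open>u = v\<close>, against irreflexivity. From here on, edges are handled through single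
  steps.\<close>

lemma tilde_dist_eq_1_iff:
  assumes "length u = length v"
  shows "tilde_dist u v = 1 \<longleftrightarrow> tilde_step u v"
proof
  assume "tilde_dist u v = 1"
  then show "tilde_step u v"
    using tilde_dist_attained[OF assms] by auto
next
  assume step: "tilde_step u v"
  then have "tilde_dist u v \<le> 1"
    unfolding tilde_dist_def by (intro Least_le) auto
  moreover have "tilde_dist u v \<noteq> 0"
  proof
    assume "tilde_dist u v = 0"
    then have "u = v"
      using tilde_dist_attained[OF assms] by simp
    with step show False
      by (simp add: tilde_step_irrefl)
  qed
  ultimately show "tilde_dist u v = 1" by simp
qed

lemma edge_set_tilde_hypercube:
  "edge_set (tilde_hypercube n) =
     {{u, v} | u v. u \<in> binary_words n \<and> v \<in> binary_words n \<and> tilde_step u v}"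
proof -
  have "tilde_dist u v = 1 \<longleftrightarrow> tilde_step u v"
    if "u \<in> binary_words n" "v \<in> binary_words n" for u v
    using that by (intro tilde_dist_eq_1_iff) (simp add: binary_words_def)
  then show ?thesis
    unfolding tilde_hypercube_def ugraph.simps by blast
qed

lemma finite_binary_words: "finite (binary_words n)"
  using finite_lists_length_eq[of "UNIV :: bool set" n] by (simp add: binary_words_def)

lemma card_binary_words: "card (binary_words n) = 2 ^ n"
  using card_lists_length_eq[of "UNIV :: bool set" n] by (simp add: binary_words_def)

lemma binary_words_Suc_iff:
  "w \<in> binary_words (Suc n) \<longleftrightarrow> (\<exists>a u. w = a # u \<and> u \<in> binary_words n)"
  by (auto simp: binary_words_def length_Suc_conv)

lemma finite_edge_set_tilde_hypercube: "finite (edge_set (tilde_hypercube n))"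
proof (rule finite_subset)
  show "edge_set (tilde_hypercube n) \<subseteq> Pow (binary_words n)"
    unfolding edge_set_tilde_hypercube by blast
qed (simp add: finite_binary_words)

text \<open>Needed to tell the two copies apart: \<open>Cons False\<close> and
  \<open>Cons True\<close> have the same image on the empty set.\<close>

lemma edge_set_tilde_hypercube_nonempty:
  "e \<in> edge_set (tilde_hypercube n) \<Longrightarrow> e \<noteq> {}"
  unfolding edge_set_tilde_hypercube by blast

lemma edge_set_tilde_hypercube_Suc_0: "edge_set (tilde_hypercube (Suc 0)) = {{[False], [True]}}"
proof -
  have words: "binary_words (Suc 0) = {[False], [True]}"
    by (auto simp: binary_words_def length_Suc_conv)
  have "tilde_step [False] [True]"
    by (simp add: tilde_step_Cons_iff)
  \<comment> \<open>The pairs with equal components are not steps, and the two orders of the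
    remaining pair give the same edge.\<close>
  then show ?thesis
    unfolding edge_set_tilde_hypercube words by (auto simp: tilde_step_irrefl)
qed

lemma edge_set_tilde_hypercube_Suc_Suc:
  "edge_set (tilde_hypercube (Suc (Suc n))) =
     (`) (Cons False) ` edge_set (tilde_hypercube (Suc n)) \<union>
     (`) (Cons True) ` edge_set (tilde_hypercube (Suc n)) \<union>
     (\<lambda>w. {False # w, True # w}) ` binary_words (Suc n) \<union>
     (\<lambda>w. {False # True # w, True # False # w}) ` binary_words n"
  (is "?E = ?F \<union> ?T \<union> ?R \<union> ?S")
proof (intro equalityI subsetI)
  fix e assume "e \<in> ?E"
  then obtain a u b v where e: "e = {a # u, b # v}" and step: "tilde_step (a # u) (b # v)"
    and words: "u \<in> binary_words (Suc n)" "v \<in> binary_words (Suc n)"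
    unfolding edge_set_tilde_hypercube binary_words_Suc_iff[of _ "Suc n"] by blast
  from step consider (same) "a = b" "tilde_step u v" | (replace) "a \<noteq> b" "u = v"
    | (swap) w where "a \<noteq> b" "u = b # w" "v = a # w"
    unfolding tilde_step_Cons_iff by blast
  then show "e \<in> ?F \<union> ?T \<union> ?R \<union> ?S"
  proof cases
    case same
    then have "{u, v} \<in> edge_set (tilde_hypercube (Suc n))"
      using words unfolding edge_set_tilde_hypercube by blast
    moreover have "e = Cons a ` {u, v}"
      using e same by simp
    ultimately have "e \<in> (`) (Cons a) ` edge_set (tilde_hypercube (Suc n))"
      by (rule rev_image_eqI)
    then show ?thesis by (cases a) simp_all
  next
    case replace
    then have "e = {False # u, True # u}"
      using e by (cases a; cases b) auto
    then show ?thesis using words by blast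
  next
    case swap
    then have "e = {False # True # w, True # False # w}"
      using e by (cases a; cases b) auto
    moreover have "w \<in> binary_words n"
      using words swap by (simp add: binary_words_def)
    ultimately show ?thesis by blast
  qed
next
  fix e assume "e \<in> ?F \<union> ?T \<union> ?R \<union> ?S"
  \<comment> \<open>Both copies are merged into one case with a common first letter
    \<open>a\<close>, so that every case displays two endpoints whose adjacency can be checked
    directly.\<close>
  then consider (same) a u v where "e = {a # u, a # v}" "u \<in> binary_words (Suc n)"
      "v \<in> binary_words (Suc n)" "tilde_step u v"
    | (replace) w where "e = {False # w, True # w}" "w \<in> binary_words (Suc n)"
    | (swap) w where "e = {False # True # w, True # False # w}" "w \<in> binary_words n"
  proof (elim UnE)
    assume "e \<in> ?F"
    then obtain u v where "e = Cons False ` {u, v}" "u \<in> binary_words (Suc n)"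
      "v \<in> binary_words (Suc n)" "tilde_step u v"
      unfolding edge_set_tilde_hypercube by blast
    then show thesis by (intro same[of False u v]) simp_all
  next
    assume "e \<in> ?T"
    then obtain u v where "e = Cons True ` {u, v}" "u \<in> binary_words (Suc n)"
      "v \<in> binary_words (Suc n)" "tilde_step u v"
      unfolding edge_set_tilde_hypercube by blast
    then show thesis by (intro same[of True u v]) simp_all
  qed blast+
  then obtain u v where "e = {u, v}" "u \<in> binary_words (Suc (Suc n))"
    "v \<in> binary_words (Suc (Suc n))" "tilde_step u v"
  proof cases
    case same
    then show ?thesis
      by (intro that[of "a # u" "a # v"]) (auto simp: binary_words_def tilde_step_Cons)
  next
    case replace
    then show ?thesis
      by (intro that[of "False # w" "True # w"]) (auto simp: binary_words_def tilde_step_Cons_iff)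
  next
    case swap
    then show ?thesis
      by (intro that[of "False # True # w" "True # False # w"])
        (auto simp: binary_words_def tilde_step_Cons_iff)
  qed
  then show "e \<in> ?E"
    unfolding edge_set_tilde_hypercube by blast
qed

lemma card_edge_set_tilde_hypercube_Suc_Suc:
  "card (edge_set (tilde_hypercube (Suc (Suc n)))) =
     2 * card (edge_set (tilde_hypercube (Suc n))) + 2 ^ Suc n + 2 ^ n"
proof -
  let ?E = "edge_set (tilde_hypercube (Suc n))"
  let ?F = "(`) (Cons False) ` ?E" and ?T = "(`) (Cons True) ` ?E"
  let ?R = "(\<lambda>w. {False # w, True # w}) ` binary_words (Suc n)"
  let ?S = "(\<lambda>w. {False # True # w, True # False # w}) ` binary_words n"
  have inj: "inj_on ((`) (Cons a)) ?E" for a :: bool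
    by (rule inj_on_image) simp
  have card_copy: "card ((`) (Cons a) ` ?E) = card ?E" for a
    by (rule card_image[OF inj])
  \<comment> \<open>The word \<open>w\<close> can be recovered from the edge, since exactly one
    endpoint starts with \<open>False\<close>; the same holds for \<open>?S\<close>.\<close>
  have card_R: "card ?R = 2 ^ Suc n"
    by (subst card_image) (auto simp: inj_on_def doubleton_eq_iff card_binary_words)
  have card_S: "card ?S = 2 ^ n"
    by (subst card_image) (auto simp: inj_on_def doubleton_eq_iff card_binary_words)
  \<comment> \<open>The set of first letters of the endpoints serves as an invariant: it separates
    the two copies from each other and from \<open>?R\<close> and \<open>?S\<close>.\<close>
  have hd_copy: "hd ` e = {a}" if e: "e \<in> (`) (Cons a) ` ?E" for a e
  proof -
    obtain d where d: "e = Cons a ` d" "d \<in> ?E"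
      using e by blast
    then have "d \<noteq> {}"
      using edge_set_tilde_hypercube_nonempty by blast
    with d show ?thesis by (simp add: image_image image_constant_conv)
  qed
  have hd_R: "hd ` e = {False, True}" if "e \<in> ?R" for e
    using that by force
  have hd_S: "hd ` e = {False, True}" if "e \<in> ?S" for e
    using that by force
  have disj_FT: "?F \<inter> ?T = {}"
    using hd_copy[of _ False] hd_copy[of _ True] by (metis disjoint_iff singleton_inject)
  have disj_cross: "(?F \<union> ?T) \<inter> (?R \<union> ?S) = {}"
  proof -
    have False if copy: "e \<in> ?F \<union> ?T" and cross: "e \<in> ?R \<union> ?S" for e
    proof -
      have "hd ` e = {False} \<or> hd ` e = {True}"
        using copy hd_copy[of e False] hd_copy[of e True] by blast
      moreover have "hd ` e = {False, True}"
        using cross hd_R[of e] hd_S[of e] by blast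
      ultimately show False by auto
    qed
    then show ?thesis by blast
  qed
  \<comment> \<open>First letters do not separate \<open>?R\<close> from \<open>?S\<close>, but
    tails do: they coincide in a replacement edge and begin with different letters in a swap
    edge.\<close>
  have "{False # v, True # v} \<noteq> {False # True # w, True # False # w}" for v w
    by (simp add: doubleton_eq_iff)
  then have disj_RS: "?R \<inter> ?S = {}"
    unfolding disjoint_iff by (metis (mono_tags, lifting) imageE)
  \<comment> \<open>Disjointness is regrouped to match the left-nested union, from which
    \<open>card_Un_disjoint\<close> removes one piece at a time.\<close>
  have disj_R: "(?F \<union> ?T) \<inter> ?R = {}" and disj_S: "(?F \<union> ?T \<union> ?R) \<inter> ?S = {}"
    using disj_RS disj_cross by (simp_all only: Int_Un_distrib Int_Un_distrib2 Un_empty simp_thms)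
  have fin: "finite ?F" "finite ?T" "finite ?R" "finite ?S"
    by (simp_all add: finite_edge_set_tilde_hypercube finite_binary_words)
  have "card (?F \<union> ?T \<union> ?R \<union> ?S) = card ?F + card ?T + card ?R + card ?S"
    using disj_FT disj_R disj_S fin by (simp only: card_Un_disjoint finite_Un simp_thms)
  then show ?thesis
    unfolding edge_set_tilde_hypercube_Suc_Suc card_copy card_R card_S by simp
qed

theorem corollary18:
  "card (edge_set (tilde_hypercube 1)) = 1 \<and>
   (\<forall>n\<ge>2. card (edge_set (tilde_hypercube n)) =
      2 * card (edge_set (tilde_hypercube (n - 1))) + 2 ^ (n - 1) + 2 ^ (n - 2))"
proof (intro conjI allI impI)
  show "card (edge_set (tilde_hypercube 1)) = 1"
    by (simp add: edge_set_tilde_hypercube_Suc_0)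
next
  fix n :: nat assume "n \<ge> 2"
  \<comment> \<open>With \<open>n\<close> in this form the truncated subtractions
    \<open>n - 1\<close> and \<open>n - 2\<close> become \<open>Suc m\<close> and
    \<open>m\<close>.\<close>
  then obtain m where "n = Suc (Suc m)"
    by (auto simp: le_iff_add)
  then show "card (edge_set (tilde_hypercube n)) =
      2 * card (edge_set (tilde_hypercube (n - 1))) + 2 ^ (n - 1) + 2 ^ (n - 2)"
    using card_edge_set_tilde_hypercube_Suc_Suc[of m] by simp
qed

end
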